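(* Let $G$ be a connected graph whose blocks are complete multipartite graphs. Then the following are equivalent. (i) $G$ is an exact $5$-leaf power. (ii) $G$ is bipartite. (iii) Every block of $G$ is complete bipartite. Moreover, if these conditions hold, then $G$ has an explicit support-tree distance-three representation obtained by replacing every block $B\cong K_{U_B,W_B}$ by one support edge $\alpha_B\beta_B$.
   Context: Graphs are finite, simple and undirected. A graph $G$ is an exact $k$-leaf power if there is a tree $T$ whose leaf set is $V(G)$ such that for distinct $u,v\in V(G)$, $uv\in E(G)$ if and only if $\operatorname{dist}_T(u,v)=k$. A support-tree distance-$d$ representation of a graph $H$ is a tree $R$ together with a map $s:V(H)\to V(R)$ such that for all distinct $u,v\in V(H)$, $uv\in E(H)$ if and only if $\operatorname{dist}_R(s(u),s(v))=d$; the case $d=3$ is called a support-tree distance-three representation. A block of $G$ is a maximal connected subgraph without a cutvertex of its own. $K_2=K_{1,1}$ is allowed as a complete bipartite block. For a complete bipartite block $B$, $U_B$ and $W_B$ denote its two sides, $K_{U_B,W_B}$ is the complete bipartite graph with these sides, and the support edge $\alpha_B\beta_B$ is an edge of the representing tree $R$ with end vertices named $\alpha_B$ and $\beta_B$. *)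

theory Defs
  imports "Graph_Theory.Graph_Theory" "HOL-Library.Disjoint_Sets"
begin

text \<open>
  A finite simple undirected graph is a \<^locale>\<open>pair_graph\<close>: finite, loop-free, and with the edge
  \<open>uv\<close> represented by the two arcs \<open>(u, v)\<close> and \<open>(v, u)\<close>.
\<close>

definition adjacent :: "'v pair_pre_digraph \<Rightarrow> 'v \<Rightarrow> 'v \<Rightarrow> bool" where
  "adjacent G u v \<longleftrightarrow> (u, v) \<in> parcs G"

text \<open>The shortest-path distance for unit arc weights; it is infinite between components.\<close>

definition gdist :: "'v pair_pre_digraph \<Rightarrow> 'v \<Rightarrow> 'v \<Rightarrow> ereal" where
  "gdist G u v = wf_digraph.\<mu> (with_proj G) (\<lambda>_. 1) u v"

text \<open>
  The library's \<open>tree\<close> forbids only directed cycles and counts \<open>u, v, u\<close> as one, so it is not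
  the undirected notion. In a simple graph the undirected cycles are the directed cycles of
  length at least three.
\<close>

definition undirected_tree :: "'v pair_pre_digraph \<Rightarrow> bool" where
  "undirected_tree T \<longleftrightarrow> pair_graph T \<and> Digraph_Component.connected (with_proj T)
     \<and> \<not> (\<exists>p. pre_digraph.cycle (with_proj T) p \<and> 3 \<le> length p)"

text \<open>
  In a tree with at least two vertices these are the vertices of degree one. The vertex of a
  one-vertex tree counts as a leaf, so that the one-vertex graph is an exact \<open>k\<close>-leaf power.
\<close>

definition leaves :: "'v pair_pre_digraph \<Rightarrow> 'v set" where
  "leaves T = {v \<in> pverts T. out_degree (with_proj T) v \<le> 1}"

text \<open>
  The leaves of \<open>T\<close> are the vertices of \<open>G\<close>, tagged by \<open>Inl\<close>; the other vertices of the finite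
  tree \<open>T\<close> can be taken from \<^typ>\<open>nat\<close> without loss of generality.
\<close>

definition exact_leaf_power :: "nat \<Rightarrow> 'v pair_pre_digraph \<Rightarrow> bool" where
  "exact_leaf_power k G \<longleftrightarrow> (\<exists>T :: ('v + nat) pair_pre_digraph.
     undirected_tree T \<and> leaves T = Inl ` pverts G \<and>
     (\<forall>u\<in>pverts G. \<forall>v\<in>pverts G. u \<noteq> v \<longrightarrow>
        (adjacent G u v \<longleftrightarrow> gdist T (Inl u) (Inl v) = ereal (real k))))"

definition support_tree_representation ::
    "nat \<Rightarrow> 'v pair_pre_digraph \<Rightarrow> 'r pair_pre_digraph \<Rightarrow> ('v \<Rightarrow> 'r) \<Rightarrow> bool" where
  "support_tree_representation d H R s \<longleftrightarrow>
     undirected_tree R \<and> s ` pverts H \<subseteq> pverts R \<and>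
     (\<forall>u\<in>pverts H. \<forall>v\<in>pverts H. u \<noteq> v \<longrightarrow>
        (adjacent H u v \<longleftrightarrow> gdist R (s u) (s v) = ereal (real d)))"

definition bipartite :: "'v pair_pre_digraph \<Rightarrow> bool" where
  "bipartite G \<longleftrightarrow>
     (\<exists>X Y. pverts G = X \<union> Y \<and> X \<inter> Y = {} \<and> parcs G \<subseteq> X \<times> Y \<union> Y \<times> X)"

definition complete_multipartite :: "'v pair_pre_digraph \<Rightarrow> bool" where
  "complete_multipartite G \<longleftrightarrow> (\<exists>P. partition_on (pverts G) P \<and>
     (\<forall>u\<in>pverts G. \<forall>v\<in>pverts G. adjacent G u v \<longleftrightarrow> \<not> (\<exists>X\<in>P. u \<in> X \<and> v \<in> X)))"

text \<open>
  A side may be empty; for a connected graph this happens only for the one-vertex graph,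
  which is its own unique block.
\<close>

definition complete_bipartite :: "'v pair_pre_digraph \<Rightarrow> bool" where
  "complete_bipartite B \<longleftrightarrow> (\<exists>m n. complete_bipartite_digraph m n (with_proj B))"

definition complete_bipartite_sides :: "'v pair_pre_digraph \<Rightarrow> 'v set \<Rightarrow> 'v set \<Rightarrow> bool" where
  "complete_bipartite_sides B U W \<longleftrightarrow>
     pverts B = U \<union> W \<and> U \<inter> W = {} \<and> parcs B = U \<times> W \<union> W \<times> U"

lemma complete_bipartite_iff_sides:
  "complete_bipartite B \<longleftrightarrow> finite (pverts B) \<and> (\<exists>U W. complete_bipartite_sides B U W)"
  unfolding complete_bipartite_def complete_bipartite_sides_def complete_bipartite_digraph_pair_def
  by auto

text \<open>A cutvertex separates two other vertices of its component.\<close>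

definition cutvertex :: "('v, 'e) pre_digraph \<Rightarrow> 'v \<Rightarrow> bool" where
  "cutvertex H c \<longleftrightarrow> c \<in> verts H \<and>
     (\<exists>x\<in>verts H - {c}. \<exists>y\<in>verts H - {c}.
        x \<rightarrow>\<^sup>*\<^bsub>H\<^esub> y \<and> \<not> x \<rightarrow>\<^sup>*\<^bsub>pre_digraph.del_vert H c\<^esub> y)"

text \<open>Requiring \<^locale>\<open>graph\<close> excludes subdigraphs that contain only one arc of an edge.\<close>

definition blocks :: "'v pair_pre_digraph \<Rightarrow> 'v pair_pre_digraph set" where
  "blocks G = {B. pre_digraph.max_subgraph (with_proj G)
     (\<lambda>H. Digraph.graph H \<and> Digraph_Component.connected H \<and> \<not> (\<exists>c. cutvertex H c)) (with_proj B)}"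

definition block_sides :: "'v pair_pre_digraph \<Rightarrow>
    ('v pair_pre_digraph \<Rightarrow> 'v set) \<Rightarrow> ('v pair_pre_digraph \<Rightarrow> 'v set) \<Rightarrow> bool" where
  "block_sides G U W \<longleftrightarrow> (\<forall>B\<in>blocks G. complete_bipartite_sides B (U B) (W B))"

datatype 'v support_vertex =
    Vert 'v
  | Alpha "'v pair_pre_digraph"
  | Beta "'v pair_pre_digraph"

text \<open>
  Every block \<open>B\<close> with sides \<open>U B\<close> and \<open>W B\<close> is replaced by the support edge
  \<open>Alpha B\<close>--\<open>Beta B\<close>, where the vertices of \<open>U B\<close> are joined to \<open>Alpha B\<close> and those of \<open>W B\<close> to
  \<open>Beta B\<close>. The vertices of the graph are kept and no edge of the graph remains.
\<close>

definition block_support_tree :: "'v pair_pre_digraph \<Rightarrow>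
    ('v pair_pre_digraph \<Rightarrow> 'v set) \<Rightarrow> ('v pair_pre_digraph \<Rightarrow> 'v set) \<Rightarrow>
    'v support_vertex pair_pre_digraph" where
  "block_support_tree G U W =
     (let E = {(Alpha B, Beta B) | B. B \<in> blocks G}
            \<union> {(Vert u, Alpha B) | u B. B \<in> blocks G \<and> u \<in> U B}
            \<union> {(Vert w, Beta B) | w B. B \<in> blocks G \<and> w \<in> W B}
      in \<lparr> pverts = Vert ` pverts G \<union> Alpha ` blocks G \<union> Beta ` blocks G,
           parcs = E \<union> E\<inverse> \<rparr>)"

end

theory Submission
  imports Defs
begin

text \<open>
  Trees are bipartite: a closed walk of odd length in a tree would contain a cycle of odd length
  (\<open>undirected_tree_no_odd_closed_walk\<close>). In an exact leaf power of odd order, adjacent vertices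
  are leaves at odd distance, so they get different colours and the graph is bipartite
  (\<open>exact_odd_leaf_power_bipartite\<close>). A bipartite graph has no triangle, while a complete
  multipartite graph with three parts has one; so the blocks are complete bipartite
  (\<open>bipartite_multipartite_imp_complete_bipartite\<close>).

  For the converse, the block support tree is a representation. Two vertices have distance three in it
  exactly if they lie on opposite sides of a common block, that is, if they are adjacent
  (\<open>support_distance\<close>). A new leaf at every vertex then makes this distance five
  (\<open>exact_leaf_power_if_support_tree\<close>).

  The main work is to show that the block support tree is a tree. It is connected as the blocks cover
  \<open>G\<close>. For acyclicity, each of its edges is shown to be a bridge. Consider the edge between a vertex
  \<open>v\<close> and the support edge of a block \<open>B\<close>. After \<open>v\<close> is deleted from \<open>G\<close>, the rest of \<open>B\<close> lies in one
  component, because \<open>v\<close> is no cutvertex of \<open>B\<close>, and \<open>B\<close> is the only block at \<open>v\<close> that meets this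
  component (\<open>blocks_joined_outside_common_vertex\<close>): otherwise a path in the component, closed up through
  \<open>v\<close>, would enlarge \<open>B\<close> to a bigger biconnected subgraph. Hence this component, with the blocks that
  meet it, is one side of a cut in the support tree that is crossed only by the given edge
  (\<open>far_cut\<close>). The cut for a support edge itself is obtained from these cuts
  (\<open>bridge_Alpha_Beta\<close>).
\<close>

section \<open>Distances and connectivity as relational facts\<close>

lemma pair_graphD_wf: "pair_graph G \<Longrightarrow> pair_wf_digraph G"
  by (simp add: pair_graph_def pair_digraph.pair_wf_digraph)

text \<open>
  Powers of the arc relation replace lists of arcs in what follows, since they are easy to transport
  along maps between graphs.
\<close>

lemma awalk_iff_relpow:
  assumes "pair_wf_digraph G" and "u \<in> pverts G"
  shows "(\<exists>p. pre_digraph.awalk (with_proj G) u p v \<and> length p = n) \<longleftrightarrow> (u, v) \<in> parcs G ^^ n"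
  using assms(2)
proof (induction n arbitrary: u)
  interpret pair_wf_digraph G by fact
  case 0
  then show ?case by (auto simp: awalk_Nil_iff)
next
  interpret pair_wf_digraph G by fact
  case (Suc n)
  have "(\<exists>p. awalk u p v \<and> length p = Suc n) \<longleftrightarrow>
      (\<exists>e p. awalk u (e # p) v \<and> length p = n)"
    by (auto simp: length_Suc_conv)
  also have "\<dots> \<longleftrightarrow> (\<exists>w. (u, w) \<in> parcs G \<and> (\<exists>p. awalk w p v \<and> length p = n))"
    by (auto simp: awalk_Cons_iff)
  also have "\<dots> \<longleftrightarrow> (\<exists>w. (u, w) \<in> parcs G \<and> (w, v) \<in> parcs G ^^ n)"
    using Suc.IH in_arcsD2 by blast
  also have "\<dots> \<longleftrightarrow> (u, v) \<in> parcs G ^^ Suc n"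
    by (metis relpow_Suc_D2 relpow_Suc_I2)
  finally show ?case .
qed

lemma gdist_eq_iff:
  assumes "pair_wf_digraph G" and u: "u \<in> pverts G"
  shows "gdist G u v = ereal (real k) \<longleftrightarrow>
    (u, v) \<in> parcs G ^^ k \<and> (\<forall>m<k. (u, v) \<notin> parcs G ^^ m)"
proof -
  interpret pair_wf_digraph G by fact
  have cost: "awalk_cost (\<lambda>_. 1) p = real (length p)" for p :: "('a \<times> 'a) list"
    by (induction p) auto
  have dist: "gdist G u v = (INF p\<in>{p. awalk u p v}. ereal (real (length p)))"
    by (simp add: gdist_def \<mu>_def cost)
  show ?thesis
  proof (cases "\<exists>p. awalk u p v")
    case False
    then have "gdist G u v = \<infinity>" unfolding dist by (simp add: top_ereal_def)
    moreover have "(u, v) \<notin> parcs G ^^ k"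
      using False awalk_iff_relpow[OF assms, of v k] by blast
    ultimately show ?thesis by auto
  next
    case True
    define l where "l = (LEAST n. (u, v) \<in> parcs G ^^ n)"
    have "\<exists>n. (u, v) \<in> parcs G ^^ n"
      using True awalk_iff_relpow[OF assms] by blast
    then have l: "(u, v) \<in> parcs G ^^ l" unfolding l_def by (rule LeastI_ex)
    have least: "(u, v) \<in> parcs G ^^ m \<Longrightarrow> l \<le> m" for m
      unfolding l_def by (rule Least_le)
    have "gdist G u v = ereal (real l)"
      unfolding dist
    proof (rule antisym)
      obtain p where "awalk u p v" "length p = l"
        using l awalk_iff_relpow[OF assms] by blast
      then show "(INF p\<in>{p. awalk u p v}. ereal (real (length p))) \<le> ereal (real l)"
        by (intro INF_lower2[of p]) auto
      show "ereal (real l) \<le> (INF p\<in>{p. awalk u p v}. ereal (real (length p)))"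
        using least awalk_iff_relpow[OF assms] by (intro INF_greatest) auto
    qed
    moreover have "l = k \<longleftrightarrow> (u, v) \<in> parcs G ^^ k \<and> (\<forall>m<k. (u, v) \<notin> parcs G ^^ m)"
      using l least by (metis le_neq_implies_less not_less)
    ultimately show ?thesis by simp
  qed
qed

lemma connected_iff:
  assumes "pair_graph G"
  shows "Digraph_Component.connected (with_proj G) \<longleftrightarrow>
    pverts G \<noteq> {} \<and> (\<forall>u\<in>pverts G. \<forall>v\<in>pverts G. (u, v) \<in> (parcs G)\<^sup>*)"
proof -
  interpret pair_graph G by fact
  have "u \<rightarrow>\<^sup>*\<^bsub>with_proj (mk_symmetric (with_proj G))\<^esub> v \<longleftrightarrow> (u, v) \<in> (parcs G)\<^sup>*"
    if "u \<in> pverts G" for u v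
    using that reachable_mk_symmetric_eq[OF sym_arcs] reachable_conv' by simp
  then show ?thesis
    unfolding Digraph_Component.connected_def strongly_connected_def by auto
qed

section \<open>Trees\<close>

lemma cut_crossed:
  assumes "(x, y) \<in> r\<^sup>*" and "x \<in> S" and "y \<notin> S"
  shows "\<exists>a b. (a, b) \<in> r \<and> a \<in> S \<and> b \<notin> S"
  using assms by (induction rule: rtrancl_induct) auto

text \<open>
  Being a bridge is expressed by a cut that only this arc leaves. Such a cut can be written down
  explicitly for the trees constructed below, whereas a direct analysis of their cycles would
  need an induction along a cycle.
\<close>

definition bridge :: "'v rel \<Rightarrow> 'v \<Rightarrow> 'v \<Rightarrow> bool" where
  "bridge E x y \<longleftrightarrow>
    (\<exists>S. x \<in> S \<and> y \<notin> S \<and> (\<forall>a b. (a, b) \<in> E \<longrightarrow> a \<in> S \<longrightarrow> b \<notin> S \<longrightarrow> a = x \<and> b = y))"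

lemma bridge_sym:
  assumes "sym E" and "bridge E x y"
  shows "bridge E y x"
proof -
  obtain S where "x \<in> S" "y \<notin> S" "\<And>a b. (a, b) \<in> E \<Longrightarrow> a \<in> S \<Longrightarrow> b \<notin> S \<Longrightarrow> a = x \<and> b = y"
    using assms(2) unfolding bridge_def by blast
  then show ?thesis
    using symD[OF assms(1)] unfolding bridge_def by (intro exI[of _ "- S"]) blast
qed

lemma awalk_crosses_cut:
  assumes "pair_wf_digraph G" and "pre_digraph.awalk (with_proj G) u p v"
    and "u \<notin> S" and "v \<in> S"
  shows "\<exists>a b. (a, b) \<in> set p \<and> a \<notin> S \<and> b \<in> S"
proof -
  interpret pair_wf_digraph G by fact
  show ?thesis using assms(2,3)
  proof (induction p arbitrary: u)
    case Nil
    then show ?case using assms(4) by (auto simp: awalk_Nil_iff)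
  next
    case (Cons e p)
    then show ?case
      by (cases e; cases "snd e \<in> S") (fastforce simp: awalk_Cons_iff)+
  qed
qed

text \<open>
  A cycle that leaves the side \<open>S\<close> of a cut along its first arc has to come back to \<open>S\<close>, and a
  bridge allows this only backwards along the same edge. So every cycle has length two.
\<close>

lemma no_cycle_if_bridges:
  assumes "pair_graph G"
    and bridges: "\<And>x y. (x, y) \<in> parcs G \<Longrightarrow> bridge (parcs G) x y"
  shows "\<not> (\<exists>p. pre_digraph.cycle (with_proj G) p \<and> 3 \<le> length p)"
proof
  interpret pair_graph G by fact
  assume "\<exists>p. cycle p \<and> 3 \<le> length p"
  then obtain p where "cycle p" and len: "3 \<le> length p" by blast
  then obtain u where walk: "awalk u p u" and dist: "distinct (tl (awalk_verts u p))"
    by (auto simp: cycle_def)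
  obtain y q where p: "p = (u, y) # q"
    using walk len by (cases p) (auto simp: awalk_Cons_iff)
  from walk have arc: "(u, y) \<in> parcs G" and q: "awalk y q u"
    by (auto simp: p awalk_Cons_iff)
  obtain S where S: "u \<in> S" "y \<notin> S"
    and only: "\<And>a b. (a, b) \<in> parcs G \<Longrightarrow> a \<in> S \<Longrightarrow> b \<notin> S \<Longrightarrow> a = u \<and> b = y"
    using bridges[OF arc] unfolding bridge_def by blast
  obtain a b where ab: "(a, b) \<in> set q" "a \<notin> S" "b \<in> S"
    using awalk_crosses_cut[OF pair_wf_digraph q S(2) S(1)] by blast
  then have "(a, b) \<in> parcs G" using q by (auto elim: awalkE)
  then have ba: "b = u" "a = y"
    using only[of b a] ab arcs_symmetric by blast+
  \<comment> \<open>The walk \<open>q\<close> from \<open>y\<close> to \<open>u\<close> visits no vertex twice, so it can use the arc \<open>(y, u)\<close> only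
     if this arc is the whole of \<open>q\<close>.\<close>
  obtain q1 q2 where q12: "q = q1 @ (y, u) # q2"
    using ab(1) ba by (auto simp: in_set_conv_decomp)
  have dq: "distinct (awalk_verts y q)" using dist by (simp add: p)
  from q have w1: "awalk y q1 y" and w2: "awalk u q2 u" by (auto simp: q12 awalk_Cons_iff)
  have "q1 = []"
  proof (rule ccontr)
    assume "q1 \<noteq> []"
    then obtain b r where r: "q = (y, b) # r" and "(y, u) \<in> set r"
      using w1 by (cases q1) (auto simp: q12 awalk_Cons_iff)
    with q have "awalk b r u" by (simp add: awalk_Cons_iff)
    then have "y \<in> set (awalk_verts b r)"
      using \<open>(y, u) \<in> set r\<close> by (auto simp: set_awalk_verts intro: rev_image_eqI)
    then show False using dq by (simp add: r)
  qed
  moreover have "q2 = []"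
  proof (rule ccontr)
    assume "q2 \<noteq> []"
    then obtain b r where r: "q2 = (u, b) # r" and "awalk b r u"
      using w2 by (cases q2) (auto simp: awalk_Cons_iff)
    then have "last (awalk_verts b r) = u" by (auto elim: awalkE)
    moreover have "awalk_verts b r \<noteq> []" by (cases r) auto
    ultimately have "u \<in> set (awalk_verts b r)" using last_in_set by blast
    then show False using dq \<open>q1 = []\<close> by (simp add: q12 r)
  qed
  ultimately show False using len by (simp add: p q12)
qed

text \<open>
  Trees are bipartite, stated for walks. If an odd closed walk repeats a vertex, it splits into two
  shorter closed walks, and one of them is odd again; otherwise it is a cycle, and its odd length
  is at least three since there are no loops.
\<close>

lemma undirected_tree_no_odd_closed_walk:
  assumes "undirected_tree T" and "odd n"
  shows "(u, u) \<notin> parcs T ^^ n"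
proof
  interpret pair_graph T using assms(1) by (simp add: undirected_tree_def)
  assume u: "(u, u) \<in> parcs T ^^ n"
  obtain m where m: "n = Suc m" using \<open>odd n\<close> by (cases n) auto
  have "u \<in> pverts T" using u unfolding m by (metis relpow_Suc_D2 in_arcsD1)
  then have "\<exists>p. awalk u p u \<and> length p = n" using u awalk_iff_relpow[OF pair_wf_digraph] by blast
  then obtain p where "awalk u p u" "odd (length p)" using assms(2) by blast
  then show False
  proof (induction "length p" arbitrary: p u rule: less_induct)
    case less
    obtain e q where p: "p = e # q" using less.prems(2) by (cases p) auto
    show False
    proof (cases "distinct (tl (awalk_verts u p))")
      case True
      then have "cycle p" using less.prems p by (auto simp: cycle_def)
      moreover have "length p \<noteq> 1"
        using less.prems(1) by (auto simp: p awalk_simps dest: no_loops)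
      ultimately have "\<not> 3 \<le> length p" "length p \<noteq> 1" "p \<noteq> []"
        using assms(1) p by (auto simp: undirected_tree_def)
      then show False using less.prems(2)
        by (cases p; cases "tl p") (auto simp: Suc_le_eq)
    next
      case False
      then have q: "awalk (snd e) q u" "\<not> distinct (awalk_verts (snd e) q)"
        using less.prems(1) by (auto simp: p awalk_Cons_iff)
      then obtain a r b w where dec: "q = a @ r @ b" "0 < length r"
        "awalk (snd e) a w" "awalk w r w" "awalk w b u"
        using awalk_not_distinct_decomp[OF q] by blast
      show False
      proof (cases "odd (length r)")
        case True
        then show False using less.hyps[of r w] dec by (auto simp: p)
      next
        case False
        have "awalk u (e # a @ b) u"
          using less.prems(1) dec by (auto simp: p awalk_Cons_iff)
        moreover have "odd (length (e # a @ b))" using False less.prems(2) by (auto simp: p dec(1))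
        ultimately show False using less.hyps[of "e # a @ b" u] dec(2) by (auto simp: p dec(1))
      qed
    qed
  qed
qed

section \<open>Biconnected vertex sets\<close>

text \<open>
  A block of a graph is determined by its vertices, so the theory of blocks is developed for
  vertex sets \<open>S\<close> and the edges that run inside \<open>S\<close>.
\<close>

definition linked :: "'v rel \<Rightarrow> 'v set \<Rightarrow> bool" where
  "linked E S \<longleftrightarrow> (\<forall>x\<in>S. \<forall>y\<in>S. (x, y) \<in> (Restr E S)\<^sup>*)"

definition biconnected :: "'v rel \<Rightarrow> 'v set \<Rightarrow> bool" where
  "biconnected E S \<longleftrightarrow> S \<noteq> {} \<and> linked E S \<and> (\<forall>c\<in>S. linked E (S - {c}))"

lemma linked_empty [simp]: "linked E {}"
  and linked_singleton [simp]: "linked E {x}"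
  by (auto simp: linked_def)

lemma linked_edge: "(x, y) \<in> E \<Longrightarrow> (y, x) \<in> E \<Longrightarrow> linked E {x, y}"
  by (auto simp: linked_def)

lemma biconnected_edge: "(x, y) \<in> E \<Longrightarrow> (y, x) \<in> E \<Longrightarrow> biconnected E {x, y}"
  by (auto simp: biconnected_def linked_edge insert_Diff_if)

lemma biconnected_singleton: "biconnected E {x}"
  by (simp add: biconnected_def)

lemma Restr_rtrancl_mono: "S \<subseteq> T \<Longrightarrow> (x, y) \<in> (Restr E S)\<^sup>* \<Longrightarrow> (x, y) \<in> (Restr E T)\<^sup>*"
  by (erule rtrancl_mono[THEN subsetD, rotated]) auto

lemma linked_Un:
  assumes "linked E S" and "linked E T" and z: "z \<in> S" "z \<in> T"
  shows "linked E (S \<union> T)"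
proof -
  have "(x, z) \<in> (Restr E (S \<union> T))\<^sup>* \<and> (z, x) \<in> (Restr E (S \<union> T))\<^sup>*" if "x \<in> S \<union> T" for x
  proof (cases "x \<in> S")
    case True
    then show ?thesis
      using assms(1) z(1) Restr_rtrancl_mono[OF Un_upper1[of S T]] by (auto simp: linked_def)
  next
    case False
    then show ?thesis
      using that assms(2) z(2) Restr_rtrancl_mono[OF Un_upper2[of T S]] by (auto simp: linked_def)
  qed
  then show ?thesis unfolding linked_def by (meson rtrancl_trans)
qed

lemma biconnected_linked_Diff: "biconnected E S \<Longrightarrow> linked E (S - {c})"
  by (cases "c \<in> S") (auto simp: biconnected_def)

text \<open>
  Deleting one vertex leaves one of the two common vertices in place, and the two remaining
  connected pieces are glued at it.
\<close>

lemma biconnected_Un: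
  assumes S: "biconnected E S" and T: "biconnected E T"
    and "x \<in> S" "x \<in> T" "y \<in> S" "y \<in> T" "x \<noteq> y"
  shows "biconnected E (S \<union> T)"
proof -
  have "linked E (S \<union> T - {c})" for c
  proof -
    obtain z where "z \<in> S - {c}" "z \<in> T - {c}" using assms(3-) by (cases "x = c") auto
    then show ?thesis
      unfolding Un_Diff using S T by (intro linked_Un[of _ _ _ z] biconnected_linked_Diff)
  qed
  moreover have "linked E (S \<union> T)"
    using assms(1-4) by (intro linked_Un[of _ _ _ x]) (auto simp: biconnected_def)
  ultimately show ?thesis using S by (auto simp: biconnected_def)
qed

abbreviation walk_list :: "'v rel \<Rightarrow> 'v list \<Rightarrow> bool" where
  "walk_list E \<equiv> successively (\<lambda>x y. (x, y) \<in> E)"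

lemma linked_walk_list:
  assumes "sym E" and "walk_list E p"
  shows "linked E (set p)"
  using assms(2)
proof (induction p)
  case Nil
  then show ?case by simp
next
  case (Cons x p)
  show ?case
  proof (cases p)
    case Nil
    then show ?thesis by simp
  next
    case (Cons y q)
    then have "linked E {x, y}" "linked E (set p)"
      using Cons.IH Cons.prems \<open>sym E\<close> by (auto intro: linked_edge dest: symD)
    then have "linked E ({x, y} \<union> set p)" by (rule linked_Un[of _ _ _ y]) (auto simp: Cons)
    then show ?thesis by (simp add: Cons insert_commute)
  qed
qed

lemma walk_list_Restr_subset: "walk_list (Restr E S) p \<Longrightarrow> hd p \<in> S \<Longrightarrow> set p \<subseteq> S"
  by (induction p rule: induct_list012) auto

text \<open>
  If a vertex of the path is deleted, the path falls into two pieces, and each of them is still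
  attached to \<open>S\<close> at its outer end. Distinctness ensures that the deleted vertex occurs
  in neither piece.
\<close>

lemma biconnected_ear:
  assumes E: "sym E" and S: "biconnected E S"
    and p: "walk_list E p" "distinct p" "p \<noteq> []" "hd p \<in> S" "last p \<in> S"
  shows "biconnected E (S \<union> set p)"
proof -
  have "linked E (S \<union> set p - {c})" for c
  proof (cases "c \<in> set p")
    case False
    then have eq: "S \<union> set p - {c} = (S - {c}) \<union> set p" by auto
    show ?thesis unfolding eq
      using False p hd_in_set[of p]
      by (intro linked_Un[of _ _ _ "hd p"] biconnected_linked_Diff[OF S] linked_walk_list[OF E]) auto
  next
    case True
    then obtain xs ys where xy: "p = xs @ c # ys" by (auto simp: in_set_conv_decomp)
    then have walks: "walk_list E xs" "walk_list E ys"
      using p(1) by (auto simp: successively_append_iff successively_Cons)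
    have 1: "linked E ((S - {c}) \<union> set xs)"
    proof (cases "xs = []")
      case True
      then show ?thesis using biconnected_linked_Diff[OF S] by simp
    next
      case False
      then show ?thesis using p xy
        by (intro linked_Un[of _ _ _ "hd xs"] biconnected_linked_Diff[OF S] linked_walk_list[OF E] walks)
          (auto dest: hd_in_set)
    qed
    have 2: "linked E ((S - {c}) \<union> set xs \<union> set ys)"
    proof (cases "ys = []")
      case True
      then show ?thesis using 1 by simp
    next
      case False
      then show ?thesis using p xy
        by (intro linked_Un[of _ _ _ "last ys"] 1 linked_walk_list[OF E] walks)
          (auto dest: last_in_set)
    qed
    have "S \<union> set p - {c} = (S - {c}) \<union> set xs \<union> set ys"
      using p(2) xy by auto
    then show ?thesis using 2 by simp
  qed
  moreover have "linked E (S \<union> set p)"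
    using S p hd_in_set[of p] by (intro linked_Un[of _ _ _ "hd p"] linked_walk_list[OF E])
      (auto simp: biconnected_def)
  ultimately show ?thesis using S by (auto simp: biconnected_def)
qed

text \<open>
  When an extension of the path meets a vertex again, the detour behind that vertex is cut off.
\<close>

lemma rtrancl_distinct_walk_list:
  assumes "(x, y) \<in> r\<^sup>*"
  shows "\<exists>p. p \<noteq> [] \<and> walk_list r p \<and> distinct p \<and> hd p = x \<and> last p = y"
  using assms
proof (induction rule: rtrancl_induct)
  case base
  then show ?case by (intro exI[of _ "[x]"]) auto
next
  case (step y z)
  then obtain p where p: "p \<noteq> []" "walk_list r p" "distinct p" "hd p = x" "last p = y" by blast
  show ?case
  proof (cases "z \<in> set p")
    case True
    then obtain xs ys where "p = xs @ z # ys" by (auto simp: in_set_conv_decomp)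
    then show ?thesis using p
      by (intro exI[of _ "xs @ [z]"]) (auto simp: successively_append_iff hd_append)
  next
    case False
    then show ?thesis using p step.hyps(2)
      by (intro exI[of _ "p @ [z]"]) (auto simp: successively_append_iff)
  qed
qed

section \<open>Blocks as maximal biconnected sets\<close>

lemma no_cutvertex_iff:
  assumes "pair_graph H"
  shows "Digraph_Component.connected (with_proj H) \<and> \<not> (\<exists>c. cutvertex (with_proj H) c) \<longleftrightarrow>
    biconnected (parcs H) (pverts H)"
proof -
  interpret pair_graph H by fact
  have Restr: "Restr (parcs H) (pverts H) = parcs H" by (auto dest: in_arcsD1 in_arcsD2)
  have conn: "Digraph_Component.connected (with_proj H) \<longleftrightarrow>
      pverts H \<noteq> {} \<and> linked (parcs H) (pverts H)"
    by (simp add: connected_iff[OF pair_graph] linked_def Restr)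
  have del: "x \<rightarrow>\<^sup>*\<^bsub>del_vert c\<^esub> y \<longleftrightarrow> (x, y) \<in> (Restr (parcs H) (pverts H - {c}))\<^sup>*"
    if "x \<in> pverts H - {c}" for x y c
  proof -
    interpret D: wf_digraph "del_vert c" by (rule wf_digraph_del_vert)
    have "arcs_ends (del_vert c) = Restr (parcs H) (pverts H - {c})"
      by (auto simp: arcs_ends_conv del_vert_def dest: in_arcsD1 in_arcsD2 intro: rev_image_eqI)
    then show ?thesis using that D.reachable_conv'[of x y] by (simp add: del_vert_def)
  qed
  have "cutvertex (with_proj H) c \<longleftrightarrow> c \<in> pverts H \<and> \<not> linked (parcs H) (pverts H - {c})"
    if "linked (parcs H) (pverts H)" for c
    using that by (auto simp: cutvertex_def linked_def del reachable_conv' Restr)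
  then show ?thesis unfolding conn biconnected_def by auto
qed

lemma linked_Restr [simp]: "linked (Restr E S) S \<longleftrightarrow> linked E S"
  by (simp add: linked_def Int_assoc)

lemma biconnected_Restr [simp]: "biconnected (Restr E S) S \<longleftrightarrow> biconnected E S"
proof -
  have "Restr (Restr E S) (S - {c}) = Restr E (S - {c})" for c by auto
  then show ?thesis by (simp add: biconnected_def linked_def Int_assoc)
qed

lemma biconnected_mono: "biconnected E S \<Longrightarrow> E \<subseteq> F \<Longrightarrow> biconnected F S"
  unfolding biconnected_def linked_def
  by (meson Int_mono rtrancl_mono subset_refl subsetD)

definition induced :: "'v pair_pre_digraph \<Rightarrow> 'v set \<Rightarrow> 'v pair_pre_digraph" where
  "induced G S = \<lparr>pverts = S, parcs = Restr (parcs G) S\<rparr>"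

lemma induced_simps [simp]: "pverts (induced G S) = S" "parcs (induced G S) = Restr (parcs G) S"
  by (simp_all add: induced_def)

lemma pair_graph_induced:
  assumes "pair_graph G" and "S \<subseteq> pverts G"
  shows "pair_graph (induced G S)"
proof -
  interpret pair_graph G by fact
  show ?thesis
  proof
    show "finite (pverts (induced G S))" "finite (parcs (induced G S))"
      using assms(2) pair_finite_verts pair_finite_arcs by (auto intro: finite_subset)
    show "symmetric (with_proj (induced G S))"
      using arcs_symmetric by (auto simp: symmetric_def intro!: symI)
  qed (auto dest: no_loops)
qed

lemma with_proj_inject [simp]: "with_proj K = with_proj L \<longleftrightarrow> K = L"
  by (cases K; cases L) (simp add: with_proj_def)

lemma subgraph_with_proj_iff:
  "subgraph (with_proj K) (with_proj L) \<longleftrightarrow> pverts K \<subseteq> pverts L \<and> parcs K \<subseteq> parcs L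
    \<and> pair_wf_digraph K \<and> pair_wf_digraph L"
  by (auto simp: subgraph_def wf_digraph_wp_iff)

lemma subgraph_of_with_proj:
  assumes "subgraph H (with_proj G)"
  obtains K where "H = with_proj K"
proof
  show "H = with_proj \<lparr>pverts = verts H, parcs = arcs H\<rparr>"
    using assms by (cases H) (auto simp: subgraph_def compatible_def with_proj_def)
qed

lemma biconnected_graph_iff:
  "(Digraph.graph (with_proj K) \<and> Digraph_Component.connected (with_proj K)
      \<and> \<not> (\<exists>c. cutvertex (with_proj K) c)) \<longleftrightarrow>
    pair_graph K \<and> biconnected (parcs K) (pverts K)"
  using no_cutvertex_iff[of K] pair_graphI_graph[of K] pair_graph.pair_graphD_graph[of K] by blast

lemma blocks_iff_maximal_graph:
  assumes "pair_graph G"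
  shows "B \<in> blocks G \<longleftrightarrow>
    pverts B \<subseteq> pverts G \<and> parcs B \<subseteq> parcs G \<and> pair_graph B \<and> biconnected (parcs B) (pverts B)
    \<and> (\<forall>K. pair_graph K \<longrightarrow> pverts B \<subseteq> pverts K \<longrightarrow> parcs B \<subseteq> parcs K \<longrightarrow> pverts K \<subseteq> pverts G
        \<longrightarrow> parcs K \<subseteq> parcs G \<longrightarrow> biconnected (parcs K) (pverts K) \<longrightarrow> K = B)" (is "_ \<longleftrightarrow> ?R")
proof
  have sub: "subgraph (with_proj K) (with_proj L) \<longleftrightarrow> pverts K \<subseteq> pverts L \<and> parcs K \<subseteq> parcs L"
    if "pair_graph K" "pair_graph L" for K L :: "'a pair_pre_digraph"
    using that by (simp add: subgraph_with_proj_iff pair_graphD_wf)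
  {
    assume "B \<in> blocks G"
    then have 1: "subgraph (with_proj B) (with_proj G)" "pair_graph B"
        "biconnected (parcs B) (pverts B)"
      and 2: "\<And>H. H \<noteq> with_proj B \<Longrightarrow> subgraph (with_proj B) H \<Longrightarrow> subgraph H (with_proj G) \<Longrightarrow>
        \<not> (Digraph.graph H \<and> Digraph_Component.connected H \<and> \<not> (\<exists>c. cutvertex H c))"
      using biconnected_graph_iff[of B] by (auto simp: blocks_def pre_digraph.max_subgraph_def)
    show ?R
    proof (intro conjI allI impI)
      show "pverts B \<subseteq> pverts G" "parcs B \<subseteq> parcs G"
        using 1(1) by (auto simp: subgraph_with_proj_iff)
      fix K
      assume K: "pair_graph K" "pverts B \<subseteq> pverts K" "parcs B \<subseteq> parcs K" "pverts K \<subseteq> pverts G"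
        "parcs K \<subseteq> parcs G" "biconnected (parcs K) (pverts K)"
      show "K = B"
      proof (rule ccontr)
        assume "K \<noteq> B"
        then have "with_proj K \<noteq> with_proj B" by simp
        moreover have "subgraph (with_proj B) (with_proj K)" "subgraph (with_proj K) (with_proj G)"
          using K 1(2) assms by (simp_all add: sub)
        ultimately show False
          using 2[of "with_proj K"] K biconnected_graph_iff[of K] by blast
      qed
    qed (use 1 in auto)
  next
    assume R: ?R
    have "\<not> (Digraph.graph H \<and> Digraph_Component.connected H \<and> \<not> (\<exists>c. cutvertex H c))"
      if H: "H \<noteq> with_proj B" "subgraph (with_proj B) H" "subgraph H (with_proj G)" for H
    proof -
      obtain K where K: "H = with_proj K" using H(3) by (rule subgraph_of_with_proj)
      show ?thesis
        using H R unfolding K biconnected_graph_iff by (auto simp: subgraph_with_proj_iff)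
    qed
    moreover have "subgraph (with_proj B) (with_proj G)"
      using R sub assms by blast
    ultimately show "B \<in> blocks G"
      using R biconnected_graph_iff[of B] by (auto simp: blocks_def pre_digraph.max_subgraph_def)
  }
qed

text \<open>
  Adding edges to a graph on the same vertices keeps it connected and creates no cutvertex. Hence a
  block is an induced subgraph, and its maximality is a property of its vertex set alone.
\<close>

lemma blocks_iff:
  assumes G: "pair_graph G"
  shows "B \<in> blocks G \<longleftrightarrow> B = induced G (pverts B) \<and> pverts B \<subseteq> pverts G
    \<and> biconnected (parcs G) (pverts B)
    \<and> (\<forall>T. pverts B \<subseteq> T \<longrightarrow> T \<subseteq> pverts G \<longrightarrow> biconnected (parcs G) T \<longrightarrow> T = pverts B)"
    (is "_ \<longleftrightarrow> ?max")
proof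
  assume "B \<in> blocks G"
  note R = this[unfolded blocks_iff_maximal_graph[OF G]]
  then have bi: "biconnected (parcs G) (pverts B)"
    using biconnected_mono[of "parcs B" "pverts B" "parcs G"] by simp
  have arcs: "parcs B \<subseteq> Restr (parcs G) (pverts B)"
  proof -
    interpret B: pair_graph B using R by blast
    show ?thesis using R by (auto dest: B.in_arcsD1 B.in_arcsD2)
  qed
  have "induced G T = B" if "pverts B \<subseteq> T" "T \<subseteq> pverts G" "biconnected (parcs G) T" for T
  proof -
    have "parcs B \<subseteq> parcs (induced G T)" using arcs that(1) by auto
    then show ?thesis
      using R that pair_graph_induced[OF G that(2)] by simp
  qed
  then show ?max
    using R bi induced_simps(1) by (metis order_refl)
next
  assume max: ?max
  then have arcs: "parcs B = Restr (parcs G) (pverts B)" by (metis induced_simps(2))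
  have "K = B" if K: "pair_graph K" "pverts B \<subseteq> pverts K" "parcs B \<subseteq> parcs K" "pverts K \<subseteq> pverts G"
      "parcs K \<subseteq> parcs G" "biconnected (parcs K) (pverts K)" for K
  proof -
    have "pverts K = pverts B"
      using max K(2,4) biconnected_mono[OF K(6,5)] by simp
    moreover have "parcs K \<subseteq> Restr (parcs G) (pverts K)"
    proof -
      interpret K: pair_graph K by fact
      show ?thesis using K(5) by (auto dest: K.in_arcsD1 K.in_arcsD2)
    qed
    ultimately show ?thesis using arcs K(3) by (intro pair_pre_digraph.equality) auto
  qed
  moreover have "pair_graph B"
    using max pair_graph_induced[OF G] by metis
  ultimately show "B \<in> blocks G"
    unfolding blocks_iff_maximal_graph[OF G] using max by (simp add: arcs)
qed

context pair_graph
begin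

lemma block_subset: "B \<in> blocks G \<Longrightarrow> pverts B \<subseteq> pverts G"
  and block_biconnected: "B \<in> blocks G \<Longrightarrow> biconnected (parcs G) (pverts B)"
  and block_maximal: "B \<in> blocks G \<Longrightarrow> pverts B \<subseteq> T \<Longrightarrow> T \<subseteq> pverts G \<Longrightarrow>
    biconnected (parcs G) T \<Longrightarrow> T = pverts B"
  by (simp_all add: blocks_iff[OF pair_graph])

lemma block_parcs: "B \<in> blocks G \<Longrightarrow> parcs B = Restr (parcs G) (pverts B)"
  by (metis blocks_iff[OF pair_graph] induced_simps(2))

lemma block_eqI: "B \<in> blocks G \<Longrightarrow> B' \<in> blocks G \<Longrightarrow> pverts B = pverts B' \<Longrightarrow> B = B'"
  by (metis blocks_iff[OF pair_graph])

lemma block_nonempty: "B \<in> blocks G \<Longrightarrow> pverts B \<noteq> {}"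
  using block_biconnected by (auto simp: biconnected_def)

lemma sym_parcs: "sym (parcs G)"
  using arcs_symmetric by (auto intro: symI)

text \<open>
  Since edges and single vertices are biconnected, this lemma shows that the blocks cover the graph.
\<close>

lemma biconnected_in_block:
  assumes "biconnected (parcs G) S" and "S \<subseteq> pverts G"
  shows "\<exists>B\<in>blocks G. S \<subseteq> pverts B"
proof -
  let ?F = "{T. S \<subseteq> T \<and> T \<subseteq> pverts G \<and> biconnected (parcs G) T}"
  have "finite ?F" by (rule finite_subset[of _ "Pow (pverts G)"]) auto
  moreover have "S \<in> ?F" using assms by auto
  ultimately obtain T where T: "T \<in> ?F" "\<And>T'. T' \<in> ?F \<Longrightarrow> T \<subseteq> T' \<Longrightarrow> T' = T"
    by (metis (no_types, lifting) finite_has_maximal2)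
  then have "induced G T \<in> blocks G"
    by (subst blocks_iff[OF pair_graph]) auto
  then show ?thesis using T(1) by force
qed

lemma vertex_in_block: "v \<in> pverts G \<Longrightarrow> \<exists>B\<in>blocks G. v \<in> pverts B"
  using biconnected_in_block[OF biconnected_singleton, of v] by simp

lemma edge_in_block: "(u, v) \<in> parcs G \<Longrightarrow> \<exists>B\<in>blocks G. u \<in> pverts B \<and> v \<in> pverts B"
  using biconnected_in_block[OF biconnected_edge, of u v] arcs_symmetric in_arcsD1 in_arcsD2 by simp

lemma block_contains:
  assumes "B \<in> blocks G" and "biconnected (parcs G) (pverts B \<union> T)" and "T \<subseteq> pverts G"
  shows "T \<subseteq> pverts B"
  using block_maximal[OF assms(1), of "pverts B \<union> T"] assms block_subset by blast

lemma blocks_share_two: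
  assumes B: "B \<in> blocks G" "B' \<in> blocks G"
    and "x \<in> pverts B" "x \<in> pverts B'" "y \<in> pverts B" "y \<in> pverts B'" "x \<noteq> y"
  shows "B = B'"
proof -
  have bi: "biconnected (parcs G) (pverts B \<union> pverts B')"
    using assms by (intro biconnected_Un[of _ _ _ x y] block_biconnected)
  have "pverts B' \<subseteq> pverts B"
    using block_contains[OF B(1) bi] block_subset[OF B(2)] by simp
  moreover have "pverts B \<subseteq> pverts B'"
    using block_contains[OF B(2), of "pverts B"] bi block_subset[OF B(1)] by (simp add: Un_commute)
  ultimately show ?thesis using B by (intro block_eqI) auto
qed

lemma block_neighbour:
  assumes "B \<in> blocks G" "v \<in> pverts B" "a \<in> pverts B - {v}"
  shows "\<exists>b\<in>pverts B - {v}. (b, v) \<in> parcs G"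
proof -
  have "(a, v) \<in> (Restr (parcs G) (pverts B))\<^sup>*"
    using block_biconnected[OF assms(1)] assms(2,3) by (auto simp: biconnected_def linked_def)
  then obtain b where "(b, v) \<in> Restr (parcs G) (pverts B)"
    using assms(3) by (metis DiffD2 insertI1 rtranclE)
  moreover have "b \<noteq> v" using calculation by (auto dest: no_loops)
  ultimately show ?thesis by blast
qed

text \<open>
  This is the acyclicity of the block structure. A path that joins the two blocks outside their
  common vertex \<open>v\<close>, prolonged inside \<open>B'\<close> to a neighbour \<open>b\<close> of \<open>v\<close> and then to \<open>v\<close> itself, is an ear
  of \<open>B\<close>. By maximality it lies inside \<open>B\<close>, so that \<open>B\<close> and \<open>B'\<close> share the two vertices \<open>v\<close> and \<open>b\<close>.
\<close>

lemma blocks_joined_outside_common_vertex: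
  assumes B: "B \<in> blocks G" "B' \<in> blocks G" and v: "v \<in> pverts B" "v \<in> pverts B'"
    and a: "a \<in> pverts B - {v}" "a' \<in> pverts B' - {v}"
    and path: "(a, a') \<in> (Restr (parcs G) (pverts G - {v}))\<^sup>*"
  shows "B = B'"
proof -
  obtain b where b: "b \<in> pverts B' - {v}" "(b, v) \<in> parcs G"
    using block_neighbour[OF B(2) v(2) a(2)] by blast
  have "(a', b) \<in> (Restr (parcs G) (pverts B' - {v}))\<^sup>*"
    using biconnected_linked_Diff[OF block_biconnected[OF B(2)]] a(2) b(1) by (auto simp: linked_def)
  then have "(a', b) \<in> (Restr (parcs G) (pverts G - {v}))\<^sup>*"
    using block_subset[OF B(2)] by (intro Restr_rtrancl_mono[of "pverts B' - {v}" "pverts G - {v}"]) auto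
  with path have "(a, b) \<in> (Restr (parcs G) (pverts G - {v}))\<^sup>*" by simp
  then obtain p where p: "p \<noteq> []" "walk_list (Restr (parcs G) (pverts G - {v})) p" "distinct p"
      "hd p = a" "last p = b"
    by (metis rtrancl_distinct_walk_list)
  have "walk_list (parcs G) p" using p(2) by (rule successively_mono) auto
  have in_V: "set p \<subseteq> pverts G - {v}"
    using walk_list_Restr_subset[OF p(2)] p(4) a(1) block_subset[OF B(1)] by auto
  \<comment> \<open>The ear: \<open>p\<close> ends at the neighbour \<open>b\<close> of \<open>v\<close>, and it does not visit \<open>v\<close>.\<close>
  have "biconnected (parcs G) (pverts B \<union> set (p @ [v]))"
  proof (rule biconnected_ear[OF sym_parcs block_biconnected[OF B(1)]])
    show "walk_list (parcs G) (p @ [v])"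
      using p \<open>walk_list (parcs G) p\<close> b(2) by (auto simp: successively_append_iff)
  qed (use p in_V a v in auto)
  then have "set (p @ [v]) \<subseteq> pverts B"
    by (rule block_contains[OF B(1)]) (use in_V v B block_subset in auto)
  then have "b \<in> pverts B" using p by (auto dest: last_in_set)
  then show ?thesis using blocks_share_two[OF B, of v b] v b by auto
qed

end

section \<open>The block support tree\<close>

locale sided_block_graph = pair_graph G for G :: "'v pair_pre_digraph" +
  fixes U W :: "'v pair_pre_digraph \<Rightarrow> 'v set"
  assumes conn: "Digraph_Component.connected (with_proj G)"
    and sides: "block_sides G U W"
begin

abbreviation R where "R \<equiv> block_support_tree G U W"

lemma block_pverts: "B \<in> blocks G \<Longrightarrow> pverts B = U B \<union> W B"
  and block_disjoint: "B \<in> blocks G \<Longrightarrow> U B \<inter> W B = {}"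
  and block_parcs_sides: "B \<in> blocks G \<Longrightarrow> parcs B = U B \<times> W B \<union> W B \<times> U B"
  using sides by (simp_all add: block_sides_def complete_bipartite_sides_def)

lemma pverts_R [simp]: "pverts R = Vert ` pverts G \<union> Alpha ` blocks G \<union> Beta ` blocks G"
  by (simp add: block_support_tree_def Let_def)

lemma arc_Vert: "(Vert v, y) \<in> parcs R \<longleftrightarrow>
    (\<exists>B\<in>blocks G. v \<in> U B \<and> y = Alpha B \<or> v \<in> W B \<and> y = Beta B)"
  and arc_Alpha: "(Alpha B, y) \<in> parcs R \<longleftrightarrow> B \<in> blocks G \<and> (y = Beta B \<or> y \<in> Vert ` U B)"
  and arc_Beta: "(Beta B, y) \<in> parcs R \<longleftrightarrow> B \<in> blocks G \<and> (y = Alpha B \<or> y \<in> Vert ` W B)"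
  by (auto simp: block_support_tree_def Let_def)

lemmas arcs_R = arc_Vert arc_Alpha arc_Beta

lemma sym_R: "sym (parcs R)"
  by (auto simp: block_support_tree_def Let_def intro: symI)

lemma finite_blocks: "finite (blocks G)"
proof (rule finite_imageD)
  show "finite (pverts ` blocks G)"
    by (rule finite_subset[of _ "Pow (pverts G)"]) (auto dest: block_subset)
  show "inj_on pverts (blocks G)" by (auto intro: inj_onI block_eqI)
qed

lemma arc_R_cases:
  assumes "(x, y) \<in> parcs R"
  obtains B where "B \<in> blocks G" "x = Alpha B" "y = Beta B"
    | B where "B \<in> blocks G" "x = Beta B" "y = Alpha B"
    | B v where "B \<in> blocks G" "v \<in> U B" "x = Alpha B" "y = Vert v"
    | B v where "B \<in> blocks G" "v \<in> U B" "x = Vert v" "y = Alpha B"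
    | B v where "B \<in> blocks G" "v \<in> W B" "x = Beta B" "y = Vert v"
    | B v where "B \<in> blocks G" "v \<in> W B" "x = Vert v" "y = Beta B"
  using assms by (cases x) (auto simp: arcs_R)

lemma pair_graph_R: "pair_graph R"
proof
  have mem: "fst e \<in> pverts R \<and> snd e \<in> pverts R" if "e \<in> parcs R" for e
    using that block_subset block_pverts
    by (cases e) (fastforce elim!: arc_R_cases)
  then show "fst e \<in> pverts R" "snd e \<in> pverts R" if "e \<in> parcs R" for e
    using that by blast+
  show fin: "finite (pverts R)" by (simp add: finite_blocks)
  have "parcs R \<subseteq> pverts R \<times> pverts R" using mem by (metis mem_Times_iff subsetI)
  then show "finite (parcs R)" using fin by (meson finite_SigmaI finite_subset)
  show "fst e \<noteq> snd e" if "e \<in> parcs R" for e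
    using that by (cases e) (auto elim: arc_R_cases)
  show "symmetric (with_proj R)" using sym_R by (simp add: symmetric_def)
qed

lemma connected_R: "Digraph_Component.connected (with_proj R)"
proof -
  note sym = symD[OF sym_rtrancl[OF sym_R]]
  have ab: "(Alpha B, Beta B) \<in> (parcs R)\<^sup>*" if "B \<in> blocks G" for B
    using that by (auto simp: arcs_R)
  have vert: "(Vert x, Alpha B) \<in> (parcs R)\<^sup>*" if "B \<in> blocks G" "x \<in> pverts B" for B x
  proof (cases "x \<in> U B")
    case True
    then show ?thesis using that by (auto simp: arcs_R)
  next
    case False
    then have "(Vert x, Beta B) \<in> (parcs R)\<^sup>*" using that block_pverts by (auto simp: arcs_R)
    then show ?thesis using sym[OF ab[OF that(1)]] by (rule rtrancl_trans)
  qed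
  obtain r where r: "r \<in> pverts G"
    and reach: "\<And>v. v \<in> pverts G \<Longrightarrow> (r, v) \<in> (parcs G)\<^sup>*"
    using conn by (auto simp: connected_iff[OF pair_graph])
  have rv: "(Vert r, Vert v) \<in> (parcs R)\<^sup>*" if "(r, v) \<in> (parcs G)\<^sup>*" for v
    using that
  proof (induction rule: rtrancl_induct)
    case (step u v)
    then obtain B where "B \<in> blocks G" "u \<in> pverts B" "v \<in> pverts B" using edge_in_block by blast
    then show ?case using step.IH vert sym by (meson rtrancl_trans)
  qed simp
  have "(Vert r, x) \<in> (parcs R)\<^sup>*" if "x \<in> pverts R" for x
  proof -
    have A: "(Vert r, Alpha B) \<in> (parcs R)\<^sup>*" if "B \<in> blocks G" for B
    proof -
      obtain v where "v \<in> pverts B" using block_nonempty[OF \<open>B \<in> blocks G\<close>] by auto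
      then show ?thesis
        using that rv reach vert block_subset by (meson rtrancl_trans subsetD)
    qed
    then show ?thesis
      using \<open>x \<in> pverts R\<close> rv reach rtrancl_trans[OF A ab] by auto
  qed
  then show ?thesis
    using r unfolding connected_iff[OF pair_graph_R]
    by (auto intro: rtrancl_trans sym simp del: pverts_R) auto
qed

text \<open>
  For a vertex \<open>v\<close> of a block \<open>B\<close> with at least two vertices, this is the component of \<open>G - v\<close> that
  contains the rest of \<open>B\<close>.
\<close>

definition beyond :: "'v pair_pre_digraph \<Rightarrow> 'v \<Rightarrow> 'v set" where
  "beyond B v = {x. \<exists>b\<in>pverts B - {v}. (b, x) \<in> (Restr (parcs G) (pverts G - {v}))\<^sup>*}"

text \<open>
  The side of the support edge of \<open>B\<close> when the edge between \<open>v\<close> and this support edge is deleted from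
  the support tree: the two ends of a support edge lie on this side if the block is \<open>B\<close> itself or
  contains a vertex beyond \<open>v\<close>. The first condition matters if \<open>B\<close> consists of \<open>v\<close> alone.
\<close>

definition far :: "'v pair_pre_digraph \<Rightarrow> 'v \<Rightarrow> 'v support_vertex set" where
  "far B v = (let M = {B'. B' = B \<or> pverts B' \<inter> beyond B v \<noteq> {}}
    in Vert ` beyond B v \<union> Alpha ` M \<union> Beta ` M)"

lemma far_iff:
  "Vert x \<in> far B v \<longleftrightarrow> x \<in> beyond B v"
  "Alpha B' \<in> far B v \<longleftrightarrow> B' = B \<or> pverts B' \<inter> beyond B v \<noteq> {}"
  "Beta B' \<in> far B v \<longleftrightarrow> B' = B \<or> pverts B' \<inter> beyond B v \<noteq> {}"
  by (auto simp: far_def Let_def)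

lemma not_beyond: "v \<notin> beyond B v"
proof
  assume "v \<in> beyond B v"
  then obtain b where "b \<noteq> v" "(b, v) \<in> (Restr (parcs G) (pverts G - {v}))\<^sup>*"
    by (auto simp: beyond_def)
  then show False by (auto elim: rtranclE)
qed

text \<open>
  A block that meets \<open>beyond B v\<close> remains connected without \<open>v\<close>, so \<open>v\<close> is the only vertex of it
  that can lie outside; and a block other than \<open>B\<close> with this property would be joined to \<open>B\<close> outside
  their common vertex \<open>v\<close>.
\<close>

lemma exit_beyond:
  assumes B: "B \<in> blocks G" "v \<in> pverts B" and B': "B' \<in> blocks G" "x \<in> pverts B'"
    and far: "B' = B \<or> pverts B' \<inter> beyond B v \<noteq> {}" and x: "x \<notin> beyond B v"
  shows "x = v \<and> B' = B"
proof (cases "B' = B")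
  case True
  then show ?thesis using B' x by (auto simp: beyond_def)
next
  case False
  then obtain y b where y: "y \<in> pverts B'" "y \<in> beyond B v" "b \<in> pverts B - {v}"
      "(b, y) \<in> (Restr (parcs G) (pverts G - {v}))\<^sup>*"
    using far by (auto simp: beyond_def)
  then have "y \<noteq> v" using not_beyond by blast
  have "x = v"
  proof (rule ccontr)
    assume "x \<noteq> v"
    then have "(y, x) \<in> (Restr (parcs G) (pverts B' - {v}))\<^sup>*"
      using biconnected_linked_Diff[OF block_biconnected[OF B'(1)]] B'(2) y(1) \<open>y \<noteq> v\<close>
      by (auto simp: linked_def)
    then have "(y, x) \<in> (Restr (parcs G) (pverts G - {v}))\<^sup>*"
      using block_subset[OF B'(1)]
      by (intro Restr_rtrancl_mono[of "pverts B' - {v}" "pverts G - {v}"]) auto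
    with y(3,4) have "x \<in> beyond B v" by (auto simp: beyond_def intro: rtrancl_trans)
    with x show False by simp
  qed
  then show ?thesis
    using blocks_joined_outside_common_vertex[OF B(1) B'(1), of v b y] B B' y \<open>y \<noteq> v\<close> by auto
qed

lemma far_cut:
  assumes B: "B \<in> blocks G" "v \<in> pverts B"
    and arc: "(x, y) \<in> parcs R" "x \<in> far B v" "y \<notin> far B v"
  shows "y = Vert v \<and> (x = Alpha B \<and> v \<in> U B \<or> x = Beta B \<and> v \<in> W B)"
  using arc(1)
proof (cases rule: arc_R_cases)
  case (3 B' u)
  then show ?thesis using exit_beyond[OF B, of B' u] arc block_pverts by (auto simp: far_iff)
next
  case (5 B' u)
  then show ?thesis using exit_beyond[OF B, of B' u] arc block_pverts by (auto simp: far_iff)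
qed (use arc block_pverts in \<open>auto simp: far_iff\<close>)

lemma bridge_Alpha_Vert:
  assumes "B \<in> blocks G" "u \<in> U B"
  shows "bridge (parcs R) (Alpha B) (Vert u)"
proof -
  have "u \<in> pverts B" "u \<notin> W B" using assms block_pverts block_disjoint by auto
  then show ?thesis
    using far_cut[OF assms(1)] not_beyond unfolding bridge_def
    by (intro exI[of _ "far B u"]) (auto simp: far_iff)
qed

lemma bridge_Beta_Vert:
  assumes "B \<in> blocks G" "w \<in> W B"
  shows "bridge (parcs R) (Beta B) (Vert w)"
proof -
  have "w \<in> pverts B" "w \<notin> U B" using assms block_pverts block_disjoint by auto
  then show ?thesis
    using far_cut[OF assms(1)] not_beyond unfolding bridge_def
    by (intro exI[of _ "far B w"]) (auto simp: far_iff)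
qed

text \<open>
  The cut consists of what \<open>Alpha B\<close> reaches without using \<open>Beta B\<close>. Besides \<open>Alpha B\<close>, the neighbours
  of \<open>Beta B\<close> are the vertices \<open>w \<in> W B\<close>, and none of them is reached: a walk from \<open>Alpha B\<close> to such
  a \<open>w\<close> has to leave \<open>far B w\<close>, which is possible only from \<open>Beta B\<close>.
\<close>

lemma bridge_Alpha_Beta:
  assumes B: "B \<in> blocks G"
  shows "bridge (parcs R) (Alpha B) (Beta B)"
proof -
  define E where "E = Restr (parcs R) (- {Beta B})"
  define S where "S = {x. (Alpha B, x) \<in> E\<^sup>*}"
  have notin: "x \<noteq> Beta B" if "x \<in> S" for x
    using that unfolding S_def E_def by (auto elim: rtranclE)
  have no_Vert: "Vert w \<notin> S" if w: "w \<in> W B" for w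
  proof
    assume "Vert w \<in> S"
    then have "(Alpha B, Vert w) \<in> E\<^sup>*" by (simp add: S_def)
    moreover have "Alpha B \<in> far B w" "Vert w \<notin> far B w"
      using not_beyond by (auto simp: far_iff)
    ultimately obtain a b where ab: "(a, b) \<in> E" "a \<in> far B w" "b \<notin> far B w"
      using cut_crossed[of "Alpha B" "Vert w" E "far B w"] by blast
    then show False
      using far_cut[OF B, of w a b] w block_pverts[OF B] block_disjoint[OF B] by (auto simp: E_def)
  qed
  have Beta_arc: "a = Alpha B \<or> a \<in> Vert ` W B" if "(a, Beta B) \<in> parcs R" for a
    using symD[OF sym_R that] by (auto simp: arcs_R)
  have exit_arc: "b = Beta B" if "(a, b) \<in> parcs R" "a \<in> S" "b \<notin> S" for a b
  proof (rule ccontr)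
    assume "b \<noteq> Beta B"
    then have "(a, b) \<in> E" using that notin by (auto simp: E_def)
    then show False using that by (auto simp: S_def intro: rtrancl_into_rtrancl)
  qed
  have "a = Alpha B \<and> b = Beta B" if "(a, b) \<in> parcs R" "a \<in> S" "b \<notin> S" for a b
    using exit_arc[OF that] Beta_arc[of a] no_Vert that by blast
  moreover have "Alpha B \<in> S" by (simp add: S_def)
  ultimately show ?thesis
    unfolding bridge_def using notin by blast
qed

lemma bridge_R:
  assumes "(x, y) \<in> parcs R"
  shows "bridge (parcs R) x y"
  using assms
  by (cases rule: arc_R_cases)
    (auto intro: bridge_Alpha_Beta bridge_Alpha_Vert bridge_Beta_Vert bridge_sym[OF sym_R])

lemma undirected_tree_R: "undirected_tree R"
  unfolding undirected_tree_def
  by (intro conjI pair_graph_R connected_R no_cycle_if_bridges bridge_R)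

lemma adjacent_iff_sides:
  "adjacent G u v \<longleftrightarrow> (\<exists>B\<in>blocks G. u \<in> U B \<and> v \<in> W B \<or> u \<in> W B \<and> v \<in> U B)"
proof
  assume "adjacent G u v"
  then have uv: "(u, v) \<in> parcs G" by (simp add: adjacent_def)
  then obtain B where "B \<in> blocks G" "u \<in> pverts B" "v \<in> pverts B" using edge_in_block by blast
  then have "B \<in> blocks G" "(u, v) \<in> parcs B" using uv by (auto simp: block_parcs)
  then show "\<exists>B\<in>blocks G. u \<in> U B \<and> v \<in> W B \<or> u \<in> W B \<and> v \<in> U B"
    by (auto simp: block_parcs_sides)
next
  assume "\<exists>B\<in>blocks G. u \<in> U B \<and> v \<in> W B \<or> u \<in> W B \<and> v \<in> U B"
  then obtain B where "B \<in> blocks G" "(u, v) \<in> parcs B" by (auto simp: block_parcs_sides)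
  then show "adjacent G u v" by (auto simp: block_parcs adjacent_def)
qed

lemma same_side_not_adjacent:
  assumes "B \<in> blocks G" "u \<in> U B \<and> v \<in> U B \<or> u \<in> W B \<and> v \<in> W B"
  shows "\<not> adjacent G u v"
proof
  assume "adjacent G u v"
  then have "(u, v) \<in> parcs B" using assms block_pverts by (auto simp: block_parcs adjacent_def)
  then show False using assms block_disjoint by (auto simp: block_parcs_sides)
qed

text \<open>
  A walk of length three between two vertices of \<open>G\<close> runs along a single support edge, so it joins the
  two sides of one block. A walk of length two would put both vertices on the same side of a block;
  such vertices are not adjacent because blocks are induced.
\<close>

lemma support_distance:
  assumes uv: "u \<in> pverts G" "u \<noteq> v"
  shows "gdist R (Vert u) (Vert v) = ereal (real 3) \<longleftrightarrow> adjacent G u v"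
proof -
  note wf = pair_graphD_wf[OF pair_graph_R]
  have 3: "(Vert u, Vert v) \<in> parcs R ^^ 3 \<longleftrightarrow> adjacent G u v"
  proof
    assume "(Vert u, Vert v) \<in> parcs R ^^ 3"
    then obtain a b where "(Vert u, a) \<in> parcs R" "(a, b) \<in> parcs R" "(b, Vert v) \<in> parcs R"
      by (auto simp: numeral_3_eq_3)
    moreover from this(3) have "(Vert v, b) \<in> parcs R" by (rule symD[OF sym_R])
    ultimately show "adjacent G u v"
      unfolding adjacent_iff_sides by (auto simp: arc_Vert arc_Alpha arc_Beta)
  next
    assume "adjacent G u v"
    then obtain B where "B \<in> blocks G" "u \<in> U B \<and> v \<in> W B \<or> u \<in> W B \<and> v \<in> U B"
      unfolding adjacent_iff_sides by blast
    then have "\<exists>a b. (Vert u, a) \<in> parcs R \<and> (a, b) \<in> parcs R \<and> (b, Vert v) \<in> parcs R"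
    proof (elim disjE conjE)
      assume "B \<in> blocks G" "u \<in> U B" "v \<in> W B"
      then show ?thesis by (intro exI[of _ "Alpha B"] exI[of _ "Beta B"]) (auto simp: arcs_R)
    next
      assume "B \<in> blocks G" "u \<in> W B" "v \<in> U B"
      then show ?thesis by (intro exI[of _ "Beta B"] exI[of _ "Alpha B"]) (auto simp: arcs_R)
    qed
    then show "(Vert u, Vert v) \<in> parcs R ^^ 3" by (auto simp: numeral_3_eq_3)
  qed
  have 2: "(Vert u, Vert v) \<notin> parcs R ^^ 2" if "adjacent G u v"
    using same_side_not_adjacent that
    by (auto simp: numeral_2_eq_2 relcomp_unfold arcs_R image_iff)
  have "(Vert u, Vert v) \<notin> parcs R ^^ m" if "adjacent G u v" "m < 3" for m
  proof -
    consider "m = 0" | "m = 1" | "m = 2" using \<open>m < 3\<close> by linarith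
    then show ?thesis
      by cases (use uv(2) 2[OF that(1)] arc_Vert[of u "Vert v"] in simp_all)
  qed
  moreover have "Vert u \<in> pverts R" using uv(1) by simp
  ultimately show ?thesis using 3 by (simp only: gdist_eq_iff[OF wf]) blast
qed

lemma support_tree_representation_R: "support_tree_representation 3 G R Vert"
  using undirected_tree_R support_distance by (auto simp: support_tree_representation_def)

end

section \<open>From support trees to leaf powers\<close>

lemma relpow_sym:
  assumes "sym r"
  shows "(x, y) \<in> r ^^ n \<Longrightarrow> (y, x) \<in> r ^^ n"
proof (induction n arbitrary: y)
  case (Suc n)
  then obtain z where "(x, z) \<in> r ^^ n" "(z, y) \<in> r" by auto
  then show ?case using Suc.IH assms by (metis relpow_Suc_I2 symD)
qed simp

lemma relpow_map:
  assumes "\<And>x y. (x, y) \<in> r \<Longrightarrow> (h x, h y) \<in> t"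
  shows "(x, y) \<in> r ^^ n \<Longrightarrow> (h x, h y) \<in> t ^^ n"
proof (induction n arbitrary: y)
  case (Suc n)
  then show ?case using assms by (auto intro: relcompI)
qed simp

text \<open>
  Walks are mapped to walks that are not longer if every arc is either contracted or kept.
\<close>

lemma relpow_lazy:
  assumes "\<And>a b. (a, b) \<in> t \<Longrightarrow> g a = g b \<or> (g a, g b) \<in> r"
  shows "(a, b) \<in> t ^^ n \<Longrightarrow> \<exists>m\<le>n. (g a, g b) \<in> r ^^ m"
proof (induction n arbitrary: b)
  case (Suc n)
  then obtain c where "(a, c) \<in> t ^^ n" "(c, b) \<in> t" by auto
  then obtain m where m: "m \<le> n" "(g a, g c) \<in> r ^^ m" using Suc.IH by blast
  from assms[OF \<open>(c, b) \<in> t\<close>] show ?case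
  proof
    assume "g c = g b"
    then show ?thesis using m by (intro exI[of _ m]) auto
  next
    assume "(g c, g b) \<in> r"
    then show ?thesis using m by (intro exI[of _ "Suc m"]) auto
  qed
qed simp

text \<open>
  A new leaf is attached to \<open>s v\<close> for every vertex \<open>v\<close>. This adds two to all distances between
  different leaves: the first and the last arc of a walk between them are pendant, and contracting
  the pendant edges maps the rest to a walk of \<open>R\<close>. The bridges of \<open>R\<close> remain bridges
  because each pendant edge lies on one side of a cut. The last hypothesis ensures that no vertex of
  \<open>R\<close> is a leaf of the new tree.
\<close>

lemma exact_leaf_power_if_support_tree:
  fixes G :: "'v pair_pre_digraph" and R :: "'r pair_pre_digraph"
  assumes fin: "finite (pverts G)" and rep: "support_tree_representation d G R s"
    and bridges: "\<And>x y. (x, y) \<in> parcs R \<Longrightarrow> bridge (parcs R) x y"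
    and inner: "\<And>x. x \<in> pverts R \<Longrightarrow> (\<exists>y z. y \<noteq> z \<and> (x, y) \<in> parcs R \<and> (x, z) \<in> parcs R)
      \<or> x \<in> s ` pverts G \<and> (\<exists>y. (x, y) \<in> parcs R)"
  shows "exact_leaf_power (d + 2) G"
proof -
  have "pair_graph R" and R: "Digraph_Component.connected (with_proj R)"
    and s: "s ` pverts G \<subseteq> pverts R"
    using rep by (auto simp: support_tree_representation_def undirected_tree_def)
  then interpret R: pair_graph R by blast
  obtain f :: "'r \<Rightarrow> nat" where f: "inj_on f (pverts R)"
    using finite_imp_inj_to_nat_seg[OF R.pair_finite_verts] by blast
  define h :: "'r \<Rightarrow> 'v + nat" where "h = Inr \<circ> f"
  \<comment> \<open>The contraction of the pendant edges: a leaf goes to the vertex that it is attached to.\<close>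
  define g :: "'v + nat \<Rightarrow> 'r" where "g = case_sum s (inv_into (pverts R) f)"
  have gh [simp]: "g (h x) = x" if "x \<in> pverts R" for x
    using that f by (simp add: g_def h_def)
  have g_Inl [simp]: "g (Inl v) = s v" for v by (simp add: g_def)
  have h_Inl [simp]: "h x \<noteq> Inl v" "Inl v \<noteq> h x" for x v by (simp_all add: h_def)
  define P :: "('v + nat) rel" where "P = {(Inl v, h (s v)) | v. v \<in> pverts G}"
  define M where "M = map_prod h h ` parcs R"
  define T where "T = \<lparr>pverts = Inl ` pverts G \<union> h ` pverts R, parcs = M \<union> P \<union> P\<inverse>\<rparr>"
  have M: "(h x, h y) \<in> M" if "(x, y) \<in> parcs R" for x y
    using that by (auto simp: M_def intro: rev_image_eqI)
  have arc_cases: thesis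
    if "(a, b) \<in> parcs T"
      "\<And>x y. (x, y) \<in> parcs R \<Longrightarrow> a = h x \<Longrightarrow> b = h y \<Longrightarrow> thesis"
      "\<And>v. v \<in> pverts G \<Longrightarrow> a = Inl v \<Longrightarrow> b = h (s v) \<Longrightarrow> thesis"
      "\<And>v. v \<in> pverts G \<Longrightarrow> b = Inl v \<Longrightarrow> a = h (s v) \<Longrightarrow> thesis" for a b thesis
    using that by (auto simp: T_def P_def M_def)
  have symT: "sym (parcs T)"
    unfolding T_def M_def P_def by (auto intro!: symI intro: rev_image_eqI dest: R.arcs_symmetric)
  have pair_T: "pair_graph T"
  proof
    fix e
    assume "e \<in> parcs T"
    then have "(fst e, snd e) \<in> parcs T" by simp
    then have "fst e \<in> pverts T \<and> snd e \<in> pverts T \<and> fst e \<noteq> snd e"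
    proof (rule arc_cases)
      fix x y
      assume xy: "(x, y) \<in> parcs R" and e: "fst e = h x" "snd e = h y"
      then have V: "x \<in> pverts R" "y \<in> pverts R" and "x \<noteq> y"
        by (auto dest: R.in_arcsD1 R.in_arcsD2 R.no_loops)
      then have "h x \<noteq> h y" using gh by metis
      then show ?thesis using V e by (simp add: T_def)
    next
      fix v
      assume "v \<in> pverts G" "fst e = Inl v" "snd e = h (s v)"
      then show ?thesis using s by (auto simp: T_def h_def)
    next
      fix v
      assume "v \<in> pverts G" "snd e = Inl v" "fst e = h (s v)"
      then show ?thesis using s by (auto simp: T_def h_def)
    qed
    then show "fst e \<in> pverts T" "snd e \<in> pverts T" "fst e \<noteq> snd e" by simp_all
  next
    show "finite (pverts T)" "finite (parcs T)"
      using fin R.pair_finite_verts R.pair_finite_arcs by (auto simp: T_def M_def P_def)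
    show "symmetric (with_proj T)" using symT by (simp add: symmetric_def)
  qed
  have hom: "(h x, h y) \<in> parcs T" if "(x, y) \<in> parcs R" for x y
    using M[OF that] by (simp add: T_def)
  have connT: "Digraph_Component.connected (with_proj T)"
  proof -
    note sym = symD[OF sym_rtrancl[OF symT]]
    obtain r where r: "r \<in> pverts R" and reach: "\<And>x. x \<in> pverts R \<Longrightarrow> (r, x) \<in> (parcs R)\<^sup>*"
      using R by (auto simp: connected_iff[OF R.pair_graph])
    have h: "(h r, h x) \<in> (parcs T)\<^sup>*" if "x \<in> pverts R" for x
      using reach[OF that] relpow_map[of "parcs R" h, OF hom]
      by (metis rtrancl_imp_relpow relpow_imp_rtrancl)
    have "(h r, Inl v) \<in> (parcs T)\<^sup>*" if "v \<in> pverts G" for v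
      using h[of "s v"] s that by (auto simp: T_def P_def intro: rtrancl_into_rtrancl)
    then have "(h r, a) \<in> (parcs T)\<^sup>*" if "a \<in> pverts T" for a
      using that h by (auto simp: T_def)
    then show ?thesis
      using r unfolding connected_iff[OF pair_T]
      by (auto intro: rtrancl_trans sym) (auto simp: T_def)
  qed
  have bridge_T: "bridge (parcs T) a b" if "(a, b) \<in> parcs T" for a b
    using that
  proof (rule arc_cases)
    fix x y
    assume xy: "(x, y) \<in> parcs R" and ab: "a = h x" "b = h y"
    obtain S where S: "x \<in> S" "y \<notin> S"
      and only: "\<And>a b. (a, b) \<in> parcs R \<Longrightarrow> a \<in> S \<Longrightarrow> b \<notin> S \<Longrightarrow> a = x \<and> b = y"
      using bridges[OF xy] unfolding bridge_def by blast
    have "c = a \<and> e = b" if "(c, e) \<in> parcs T" "g c \<in> S" "g e \<notin> S" for c e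
      using that(1)
    proof (rule arc_cases)
      fix x' y'
      assume "(x', y') \<in> parcs R" "c = h x'" "e = h y'"
      moreover from this have "x' \<in> pverts R" "y' \<in> pverts R"
        by (auto dest: R.in_arcsD1 R.in_arcsD2)
      ultimately show ?thesis using only[of x' y'] that(2,3) ab by simp
    qed (use that s in \<open>auto simp: image_subset_iff\<close>)
    moreover have "g a \<in> S" "g b \<notin> S" using S xy ab by (auto dest: R.in_arcsD1 R.in_arcsD2)
    ultimately show ?thesis unfolding bridge_def by (intro exI[of _ "g -` S"]) auto
  next
    fix v
    assume "v \<in> pverts G" "a = Inl v" "b = h (s v)"
    then show ?thesis unfolding bridge_def
      by (intro exI[of _ "{a}"]) (auto elim: arc_cases)
  next
    fix v
    assume "v \<in> pverts G" "b = Inl v" "a = h (s v)"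
    then have "bridge (parcs T) b a" unfolding bridge_def
      by (intro exI[of _ "{b}"]) (auto elim: arc_cases)
    then show ?thesis by (rule bridge_sym[OF symT])
  qed
  have tree: "undirected_tree T"
    using pair_T connT no_cycle_if_bridges[OF pair_T bridge_T] by (simp add: undirected_tree_def)
  have walk: "(Inl u, Inl v) \<in> parcs T ^^ (m + 2)"
    if "u \<in> pverts G" "v \<in> pverts G" "(s u, s v) \<in> parcs R ^^ m" for u v m
  proof -
    have "(h (s u), h (s v)) \<in> parcs T ^^ m"
      by (rule relpow_map[of "parcs R" h, OF hom that(3)])
    moreover have "(Inl u, h (s u)) \<in> parcs T" "(h (s v), Inl v) \<in> parcs T"
      using that by (auto simp: T_def P_def)
    ultimately show ?thesis by (metis add_2_eq_Suc' relpow_Suc_I relpow_Suc_I2)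
  qed
  have shorten: "\<exists>m. m + 2 \<le> n \<and> (s u, s v) \<in> parcs R ^^ m"
    if uv: "u \<in> pverts G" "v \<in> pverts G" "u \<noteq> v" and n: "(Inl u, Inl v) \<in> parcs T ^^ n" for u v n
  proof -
    have "n \<noteq> 0" using uv n by (cases n) auto
    moreover have "n \<noteq> 1" using n by (auto elim!: arc_cases)
    ultimately obtain k where k: "n = Suc (Suc k)" by (metis One_nat_def not0_implies_Suc)
    obtain a b where ab: "(Inl u, a) \<in> parcs T" "(a, b) \<in> parcs T ^^ k" "(b, Inl v) \<in> parcs T"
      using n unfolding k by (metis relpow_Suc_D2 relpow_Suc_E)
    have "a = h (s u)" "b = h (s v)" using ab(1,3) by (auto elim!: arc_cases)
    moreover have "\<exists>m\<le>k. (g a, g b) \<in> parcs R ^^ m"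
      using ab(2)
    proof (rule relpow_lazy[rotated])
      show "g c = g e \<or> (g c, g e) \<in> parcs R" if "(c, e) \<in> parcs T" for c e
        using that
      proof (rule arc_cases)
        fix x y
        assume "(x, y) \<in> parcs R" "c = h x" "e = h y"
        then show ?thesis using R.in_arcsD1[of x y] R.in_arcsD2[of x y] by simp
      qed (use s in auto)
    qed
    ultimately show ?thesis using s uv k by (auto simp: image_subset_iff)
  qed
  have dist: "gdist T (Inl u) (Inl v) = ereal (real (d + 2)) \<longleftrightarrow>
      gdist R (s u) (s v) = ereal (real d)"
    if uv: "u \<in> pverts G" "v \<in> pverts G" "u \<noteq> v" for u v
  proof -
    have V: "Inl u \<in> pverts T" "s u \<in> pverts R" using uv s by (auto simp: T_def)
    have "(Inl u, Inl v) \<in> parcs T ^^ (d + 2) \<and> (\<forall>m<d + 2. (Inl u, Inl v) \<notin> parcs T ^^ m) \<longleftrightarrow>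
        (s u, s v) \<in> parcs R ^^ d \<and> (\<forall>m<d. (s u, s v) \<notin> parcs R ^^ m)" (is "?T \<longleftrightarrow> ?R")
    proof
      assume ?T
      have no_short: "(s u, s v) \<notin> parcs R ^^ m" if "m < d" for m
      proof
        assume "(s u, s v) \<in> parcs R ^^ m"
        then have "(Inl u, Inl v) \<in> parcs T ^^ (m + 2)" by (rule walk[OF uv(1,2)])
        moreover have "m + 2 < d + 2" using that by simp
        ultimately show False using \<open>?T\<close> by blast
      qed
      obtain m where "m + 2 \<le> d + 2" "(s u, s v) \<in> parcs R ^^ m"
        using shorten[OF uv] \<open>?T\<close> by blast
      moreover from this have "m = d" using no_short[of m] by linarith
      ultimately show ?R using no_short by simp
    next
      assume R: ?R
      have "(Inl u, Inl v) \<notin> parcs T ^^ m" if "m < d + 2" for m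
      proof
        assume "(Inl u, Inl v) \<in> parcs T ^^ m"
        then obtain m' where "m' + 2 \<le> m" "(s u, s v) \<in> parcs R ^^ m'"
          using shorten[OF uv] by blast
        moreover from this have "m' < d" using that by linarith
        ultimately show False using R by blast
      qed
      then show ?T using walk[OF uv(1,2)] R by blast
    qed
    then show ?thesis
      unfolding gdist_eq_iff[OF pair_graphD_wf[OF pair_T] V(1)]
        gdist_eq_iff[OF R.pair_wf_digraph V(2)] .
  qed
  have leaves_T: "leaves T = Inl ` pverts G"
  proof -
    interpret T: pair_graph T by (rule pair_T)
    have deg: "out_degree (with_proj T) a = card {e \<in> parcs T. fst e = a}" for a
      by (simp add: out_degree_def out_arcs_def)
    have "out_degree (with_proj T) (Inl v) = 1" if "v \<in> pverts G" for v
    proof -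
      have "{e \<in> parcs T. fst e = Inl v} = {(Inl v, h (s v))}"
        using that by (auto simp: T_def M_def P_def)
      then show ?thesis by (simp add: deg)
    qed
    moreover have "\<not> out_degree (with_proj T) (h x) \<le> 1" if x: "x \<in> pverts R" for x
    proof -
      have two: "\<exists>b c. b \<noteq> c \<and> (h x, b) \<in> parcs T \<and> (h x, c) \<in> parcs T"
        using inner[OF x]
      proof
        assume "\<exists>y z. y \<noteq> z \<and> (x, y) \<in> parcs R \<and> (x, z) \<in> parcs R"
        then obtain y z where yz: "y \<noteq> z" "(x, y) \<in> parcs R" "(x, z) \<in> parcs R" by blast
        then have "h y \<noteq> h z" using gh by (metis R.in_arcsD2)
        then show ?thesis using M yz by (auto simp: T_def)
      next
        assume "x \<in> s ` pverts G \<and> (\<exists>y. (x, y) \<in> parcs R)"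
        then obtain v y where "v \<in> pverts G" "x = s v" "(x, y) \<in> parcs R" by blast
        then show ?thesis using M h_Inl(2)[of v y]
          by (intro exI[of _ "Inl v"] exI[of _ "h y"]) (auto simp: T_def P_def)
      qed
      have "finite {e \<in> parcs T. fst e = h x}" using T.pair_finite_arcs by simp
      then show ?thesis using two by (fastforce simp: deg card_le_Suc0_iff_eq)
    qed
    ultimately show ?thesis by (auto simp: leaves_def T_def)
  qed
  show ?thesis
    unfolding exact_leaf_power_def
    using tree leaves_T dist rep
    by (intro exI[of _ T]) (auto simp: support_tree_representation_def)
qed

text \<open>
  A one-vertex graph needs its own tree: in its block support tree, the end of the support edge that
  belongs to the empty side would be a surplus leaf.
\<close>

lemma exact_leaf_power_singleton:
  assumes "pverts G = {v}"
  shows "exact_leaf_power k G"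
proof -
  define T :: "('a + nat) pair_pre_digraph" where "T = \<lparr>pverts = {Inl v}, parcs = {}\<rparr>"
  have T: "pair_graph T" by unfold_locales (auto simp: T_def symmetric_def intro: symI)
  have "Digraph_Component.connected (with_proj T)"
    unfolding connected_iff[OF T] by (simp add: T_def)
  then have "undirected_tree T"
    using no_cycle_if_bridges[OF T] T by (simp add: undirected_tree_def T_def)
  moreover have "leaves T = {Inl v}"
    by (auto simp: leaves_def T_def out_degree_def out_arcs_def)
  ultimately show ?thesis
    unfolding exact_leaf_power_def using assms by (intro exI[of _ T]) auto
qed

context sided_block_graph
begin

text \<open>
  In a connected graph with another vertex than \<open>x\<close>, no block consists of \<open>x\<close> alone, because an edge
  at \<open>x\<close> is a larger biconnected set. So the block has an edge, which joins its two sides.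
\<close>

lemma sides_nonempty:
  assumes two: "pverts G \<noteq> {x}" and B: "B \<in> blocks G" and x: "x \<in> pverts B"
  shows "U B \<noteq> {}" "W B \<noteq> {}"
proof -
  have "\<exists>a. a \<in> pverts B - {x}"
  proof (rule ccontr)
    assume "\<nexists>a. a \<in> pverts B - {x}"
    then have single: "pverts B = {x}" using x by blast
    have xG: "x \<in> pverts G" using B x block_subset by blast
    then obtain y where "y \<in> pverts G" "y \<noteq> x" using two by blast
    then have "(x, y) \<in> (parcs G)\<^sup>*" "y \<noteq> x"
      using conn xG by (auto simp: connected_iff[OF pair_graph])
    then obtain z where z: "(x, z) \<in> parcs G" by (auto elim: converse_rtranclE)
    then have "{x, z} = pverts B"
      using block_maximal[OF B, of "{x, z}"] biconnected_edge[of x z] single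
      by (auto dest: in_arcsD1 in_arcsD2 arcs_symmetric)
    then show False using single z no_loops by force
  qed
  then obtain b where b: "b \<in> pverts B" "(b, x) \<in> parcs G"
    using block_neighbour[OF B x] by blast
  then have "(b, x) \<in> parcs B" using B x by (simp add: block_parcs)
  then show "U B \<noteq> {}" "W B \<noteq> {}" using B by (auto simp: block_parcs_sides)
qed

lemma exact_5_leaf_power: "exact_leaf_power 5 G"
proof (cases "\<exists>v. pverts G = {v}")
  case True
  then show ?thesis by (auto intro: exact_leaf_power_singleton)
next
  case False
  have nonempty: "U B \<noteq> {} \<and> W B \<noteq> {}" if B: "B \<in> blocks G" for B
  proof -
    obtain x where x: "x \<in> pverts B" using block_nonempty[OF B] by auto
    have "pverts G \<noteq> {x}" using False by simp
    then show ?thesis using sides_nonempty[OF _ B x] by simp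
  qed
  have "exact_leaf_power (3 + 2) G"
  proof (rule exact_leaf_power_if_support_tree[OF _ support_tree_representation_R])
    show "finite (pverts G)" by simp
    show "bridge (parcs R) x y" if "(x, y) \<in> parcs R" for x y using that by (rule bridge_R)
    show "(\<exists>y z. y \<noteq> z \<and> (x, y) \<in> parcs R \<and> (x, z) \<in> parcs R)
      \<or> x \<in> Vert ` pverts G \<and> (\<exists>y. (x, y) \<in> parcs R)" if "x \<in> pverts R" for x
    proof (cases x)
      case (Vert v)
      then have v: "v \<in> pverts G" using that by auto
      then obtain B where "B \<in> blocks G" "v \<in> pverts B" using vertex_in_block by blast
      then show ?thesis using Vert v block_pverts by (auto simp: arcs_R)
    next
      case (Alpha B)
      then have B: "B \<in> blocks G" using that by auto
      then obtain u where "u \<in> U B" using nonempty by auto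
      then have "(x, Beta B) \<in> parcs R" "(x, Vert u) \<in> parcs R"
        using B Alpha by (auto simp: arcs_R)
      then show ?thesis by blast
    next
      case (Beta B)
      then have B: "B \<in> blocks G" using that by auto
      then obtain w where "w \<in> W B" using nonempty by auto
      then have "(x, Alpha B) \<in> parcs R" "(x, Vert w) \<in> parcs R"
        using B Beta by (auto simp: arcs_R)
      then show ?thesis by blast
    qed
  qed
  then show ?thesis by simp
qed

end

section \<open>Bipartiteness\<close>

text \<open>
  The vertices are coloured by the parity of the walks that lead to their leaves from a fixed
  vertex of the tree. The parity is well defined because the tree has no odd closed walk, and
  adjacent vertices have different parities because their leaves have odd distance.
\<close>

lemma exact_odd_leaf_power_bipartite:
  assumes G: "pair_graph G" and "exact_leaf_power k G" and "odd k"
  shows "bipartite G"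
proof -
  interpret pair_graph G by fact
  obtain T :: "('a + nat) pair_pre_digraph" where tree: "undirected_tree T"
    and leaves: "leaves T = Inl ` pverts G"
    and dist: "\<And>u v. u \<in> pverts G \<Longrightarrow> v \<in> pverts G \<Longrightarrow> u \<noteq> v \<Longrightarrow>
      adjacent G u v \<longleftrightarrow> gdist T (Inl u) (Inl v) = ereal (real k)"
    using assms(2) unfolding exact_leaf_power_def by blast
  from tree have T: "pair_graph T" and connT: "Digraph_Component.connected (with_proj T)"
    by (simp_all add: undirected_tree_def)
  interpret T: pair_graph T by (rule T)
  have symT: "sym (parcs T)" using T.arcs_symmetric by (auto intro: symI)
  have leaf: "Inl u \<in> pverts T" if "u \<in> pverts G" for u
    using leaves that by (auto simp: leaves_def)
  obtain r where reach: "\<And>a. a \<in> pverts T \<Longrightarrow> \<exists>n. (r, a) \<in> parcs T ^^ n"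
    using connT by (auto simp: connected_iff[OF T] rtrancl_is_UN_relpow)
  define X where "X = {u \<in> pverts G. \<exists>n. even n \<and> (r, Inl u) \<in> parcs T ^^ n}"
  define Y where "Y = {u \<in> pverts G. \<exists>n. odd n \<and> (r, Inl u) \<in> parcs T ^^ n}"
  have "u \<in> X \<union> Y" if u: "u \<in> pverts G" for u
  proof -
    obtain n where "(r, Inl u) \<in> parcs T ^^ n" using reach[OF leaf[OF u]] by blast
    then show ?thesis using u by (cases "even n") (auto simp: X_def Y_def)
  qed
  then have "pverts G = X \<union> Y" by (auto simp: X_def Y_def)
  moreover have "X \<inter> Y = {}"
  proof -
    have False if "(r, a) \<in> parcs T ^^ n" "(r, a) \<in> parcs T ^^ m" "even n" "odd m" for a n m
    proof -
      have "(r, r) \<in> parcs T ^^ (n + m)"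
        using that(1) relpow_sym[OF symT that(2)] by (auto simp: relpow_add)
      then show False using undirected_tree_no_odd_closed_walk[OF tree] that(3,4) by auto
    qed
    then show ?thesis by (auto simp: X_def Y_def)
  qed
  moreover have "parcs G \<subseteq> X \<times> Y \<union> Y \<times> X"
  proof
    fix e
    assume "e \<in> parcs G"
    then obtain u v where e: "e = (u, v)" and uv: "(u, v) \<in> parcs G" by (cases e) auto
    then have V: "u \<in> pverts G" "v \<in> pverts G" by (auto dest: in_arcsD1 in_arcsD2)
    have "gdist T (Inl u) (Inl v) = ereal (real k)"
      using dist[OF V] uv no_loops by (fastforce simp: adjacent_def)
    then have k: "(Inl u, Inl v) \<in> parcs T ^^ k"
      by (simp add: gdist_eq_iff[OF T.pair_wf_digraph leaf[OF V(1)]])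
    obtain n where n: "(r, Inl u) \<in> parcs T ^^ n" using reach leaf V by blast
    have nk: "(r, Inl v) \<in> parcs T ^^ (n + k)" using n k by (auto simp: relpow_add)
    show "e \<in> X \<times> Y \<union> Y \<times> X"
    proof (cases "even n")
      case True
      then have "odd (n + k)" using \<open>odd k\<close> by simp
      then have "u \<in> X" "v \<in> Y" using n nk V True unfolding X_def Y_def by blast+
      then show ?thesis by (simp add: e)
    next
      case False
      then have "even (n + k)" using \<open>odd k\<close> by simp
      then have "u \<in> Y" "v \<in> X" using n nk V False unfolding X_def Y_def by blast+
      then show ?thesis by (simp add: e)
    qed
  qed
  ultimately show ?thesis unfolding bipartite_def by blast
qed

text \<open>
  One part \<open>A\<close> is taken as one side. An edge that avoids \<open>A\<close> would form a triangle with any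
  vertex of \<open>A\<close>, and a bipartite graph has no triangle.
\<close>

lemma bipartite_multipartite_imp_complete_bipartite:
  assumes B: "pair_graph B" and "bipartite B" and "complete_multipartite B"
  shows "complete_bipartite B"
proof -
  interpret pair_graph B by fact
  obtain P where P: "partition_on (pverts B) P"
    and adj: "\<And>u v. u \<in> pverts B \<Longrightarrow> v \<in> pverts B \<Longrightarrow>
      (u, v) \<in> parcs B \<longleftrightarrow> \<not> (\<exists>X\<in>P. u \<in> X \<and> v \<in> X)"
    using assms(3) unfolding complete_multipartite_def adjacent_def by blast
  obtain X Y where XY: "X \<inter> Y = {}" "parcs B \<subseteq> X \<times> Y \<union> Y \<times> X"
    using assms(2) unfolding bipartite_def by blast
  have triangle: False if "(a, b) \<in> parcs B" "(b, c) \<in> parcs B" "(a, c) \<in> parcs B" for a b c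
    using that XY by blast
  have "\<exists>A. A \<subseteq> pverts B \<and> complete_bipartite_sides B A (pverts B - A)"
  proof (cases "P = {}")
    case True
    then have "pverts B = {}" using P by (auto simp: partition_on_def)
    then show ?thesis by (auto simp: complete_bipartite_sides_def dest: in_arcsD1)
  next
    case False
    then obtain A where A: "A \<in> P" by blast
    then have "A \<noteq> {}" using P by (auto simp: partition_on_def)
    then obtain a where a: "a \<in> A" by blast
    have sub: "A \<subseteq> pverts B" using P A by (auto simp: partition_on_def)
    have across: "(u, v) \<in> parcs B" if "u \<in> A" "v \<in> pverts B - A" for u v
    proof -
      have "\<not> (\<exists>X\<in>P. u \<in> X \<and> v \<in> X)"
        using that A P by (auto simp: partition_on_def disjoint_def)
      then show ?thesis using adj that sub by blast
    qed
    have "(u, v) \<in> A \<times> (pverts B - A) \<union> (pverts B - A) \<times> A" if uv: "(u, v) \<in> parcs B" for u v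
    proof -
      have V: "u \<in> pverts B" "v \<in> pverts B" using uv by (auto dest: in_arcsD1 in_arcsD2)
      have "\<not> (u \<in> A \<and> v \<in> A)" using adj[OF V] uv A by blast
      moreover have "u \<in> A \<or> v \<in> A"
        using triangle[OF across[OF a] uv across[OF a]] V by blast
      ultimately show ?thesis using V by blast
    qed
    then have "parcs B = A \<times> (pverts B - A) \<union> (pverts B - A) \<times> A"
      using across arcs_symmetric by auto
    then show ?thesis using sub by (auto simp: complete_bipartite_sides_def)
  qed
  then show ?thesis unfolding complete_bipartite_iff_sides by auto
qed

lemma bipartite_block:
  assumes "pair_graph G" "bipartite G" "B \<in> blocks G"
  shows "bipartite B"
proof -
  interpret pair_graph G by fact
  obtain X Y where "pverts G = X \<union> Y" "X \<inter> Y = {}" "parcs G \<subseteq> X \<times> Y \<union> Y \<times> X"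
    using assms(2) unfolding bipartite_def by blast
  then show ?thesis
    unfolding bipartite_def using block_subset[OF assms(3)] block_parcs[OF assms(3)]
    by (intro exI[of _ "X \<inter> pverts B"] exI[of _ "Y \<inter> pverts B"]) auto
qed

lemma exists_block_sides:
  assumes "\<forall>B\<in>blocks G. complete_bipartite B"
  shows "\<exists>U W. block_sides G U W"
  using assms unfolding block_sides_def complete_bipartite_iff_sides by metis

theorem theorem4p2:
  fixes G :: "'v pair_pre_digraph"
  assumes "pair_graph G"
    and "Digraph_Component.connected (with_proj G)"
    and "\<forall>B\<in>blocks G. complete_multipartite B"
  shows "(exact_leaf_power 5 G \<longleftrightarrow> bipartite G)
    \<and> (bipartite G \<longleftrightarrow> (\<forall>B\<in>blocks G. complete_bipartite B))
    \<and> ((\<forall>B\<in>blocks G. complete_bipartite B) \<longrightarrow>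
         (\<exists>U W. block_sides G U W) \<and>
         (\<forall>U W. block_sides G U W \<longrightarrow>
            support_tree_representation 3 G (block_support_tree G U W) Vert))"
proof -
  have sided: "sided_block_graph G U W" if "block_sides G U W" for U W
    using assms(1,2) that
    by (simp add: sided_block_graph_def sided_block_graph_axioms_def)
  have "bipartite G" if "exact_leaf_power 5 G"
    using exact_odd_leaf_power_bipartite[OF assms(1) that] by simp
  moreover have "complete_bipartite B" if "bipartite G" "B \<in> blocks G" for B
  proof -
    have "pair_graph B"
      using that(2) pair_graph_induced[OF assms(1)] by (metis blocks_iff[OF assms(1)])
    then show ?thesis
      using bipartite_multipartite_imp_complete_bipartite bipartite_block[OF assms(1) that]
        assms(3) that(2) by blast
  qed
  moreover have "exact_leaf_power 5 G" if "\<forall>B\<in>blocks G. complete_bipartite B"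
    using exists_block_sides[OF that] sided sided_block_graph.exact_5_leaf_power by blast
  moreover have "support_tree_representation 3 G (block_support_tree G U W) Vert"
    if "block_sides G U W" for U W
    using sided_block_graph.support_tree_representation_R[OF sided[OF that]] .
  ultimately show ?thesis using exists_block_sides by blast
qed

end
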